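(* Let $p\in[0,1]$ and $q=1-p$. If the server has probability $p$ of winning each point, then the probability $\theta_{GT}(p)$ that the server wins the game tie-breaker is $$\theta_{GT}(p)=\frac{p^2}{1-2pq}=\frac{p^2}{p^2+q^2},$$ and, for $p<1$, this also equals $$\frac{(ODDS(p))^2}{1+(ODDS(p))^2}.$$ Moreover $\theta_{GT}(1-p)=1-\theta_{GT}(p)$.
   Context: $ODDS(p)=p/(1-p)$. Game tie-breaker (deuce) in tennis: one player (the server) serves all points. The outcomes $V_1,V_2,\ldots$ are independent Bernoulli random variables with $\Pr\{V_i=1\}=p$, where $V_i=1$ means the server wins the $i$th point and $V_i=0$ means the receiver wins it. Starting from an even score, points are played until one player is ahead by two points for the first time; that player wins the tie-breaker. *)

theory Defs
  imports "HOL-Probability.Probability"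
begin

definition ODDS :: "real \<Rightarrow> real" where
  "ODDS p = p / (1 - p)"

text \<open>
  A record of points is a sequence \<open>v :: nat \<Rightarrow> bool\<close>; \<open>v i\<close> holds iff the server wins the
  point numbered \<open>i\<close>, so \<open>True\<close> and \<open>False\<close> stand for the values 1 and 0 of the Bernoulli
  variables. Points are numbered from 0, hence \<open>v i\<close> is the outcome of the point number \<open>i + 1\<close>
  in the usual counting.
\<close>

definition server_points :: "(nat \<Rightarrow> bool) \<Rightarrow> nat \<Rightarrow> nat" where
  "server_points v n = card {i. i < n \<and> v i}"

definition receiver_points :: "(nat \<Rightarrow> bool) \<Rightarrow> nat \<Rightarrow> nat" where
  "receiver_points v n = card {i. i < n \<and> \<not> v i}"

definition server_lead :: "(nat \<Rightarrow> bool) \<Rightarrow> nat \<Rightarrow> int" where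
  "server_lead v n = int (server_points v n) - int (receiver_points v n)"

text \<open>
  The server is two points ahead after \<open>n\<close> points, and at no earlier time was either player two
  points ahead. On records in which nobody ever leads by two, the server does not win.
\<close>

definition server_wins_GT :: "(nat \<Rightarrow> bool) \<Rightarrow> bool" where
  "server_wins_GT v \<longleftrightarrow> (\<exists>n. server_lead v n = 2 \<and> (\<forall>m<n. \<bar>server_lead v m\<bar> < 2))"

definition bernoulli_points :: "'a measure \<Rightarrow> (nat \<Rightarrow> 'a \<Rightarrow> bool) \<Rightarrow> real \<Rightarrow> bool" where
  "bernoulli_points M V p \<longleftrightarrow>
     prob_space M \<and>
     prob_space.indep_vars M (\<lambda>_. count_space UNIV) V UNIV \<and>
     (\<forall>i. distr M (count_space UNIV) (V i) = measure_pmf (bernoulli_pmf p))"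

text \<open>
  The winning probability as a function of \<open>p\<close> alone, computed in the canonical model of
  independent Bernoulli trials, the countable product of Bernoulli measures.
  It is meant for \<open>p \<in> {0..1}\<close>, where \<open>bernoulli_pmf p\<close> gives \<open>True\<close> the probability \<open>p\<close>.
\<close>

definition theta_GT :: "real \<Rightarrow> real" where
  "theta_GT p =
     measure (Pi\<^sub>M (UNIV :: nat set) (\<lambda>_. measure_pmf (bernoulli_pmf p))) {v. server_wins_GT v}"

end

theory Submission imports Defs
begin

text \<open>
  The tie-breaker renews itself after every two points. Two points won by the same player end it;
  one point each restores an even score, and the points still to come are again independent
  Bernoulli trials. Hence \<open>theta_GT p = p\<^sup>2 + 2 * p * q * theta_GT p\<close>, and since
  \<open>1 - 2 * p * q = p\<^sup>2 + q\<^sup>2\<close> is positive, this linear equation determines \<open>theta_GT p\<close>.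

  The renewal has a deterministic half, \<open>server_wins_GT_two_points\<close>, which is about
  records only, and a probabilistic half, \<open>measure_trials_first_point\<close>, which says that the
  points after the first are, whatever the first one was, again a sequence of independent Bernoulli
  trials with the same parameter. Applying the latter
  twice gives the equation above (\<open>theta_GT_first_step\<close>). Any other model of the trials has
  the product measure as the joint law of its outcomes, and so the same winning probability. The
  symmetry \<open>theta_GT (1 - p) = 1 - theta_GT p\<close> is read off the closed form; it reflects that
  an endless tie-breaker, which would count for neither player, has probability zero.
\<close>

abbreviation trials :: "real \<Rightarrow> (nat \<Rightarrow> bool) measure" where
  "trials p \<equiv> Pi\<^sub>M UNIV (\<lambda>_. measure_pmf (bernoulli_pmf p))"

text \<open>
  In a sum of \<open>\<plusminus>1\<close> steps one step can be split off at the end, for the induction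
  that proves measurability, or at the start, for the renewal.
\<close>

lemma server_lead_eq_sum: "server_lead v n = (\<Sum>i<n. if v i then 1 else -1)"
proof -
  have "{i. i < n \<and> v i} = {..<n} \<inter> {i. v i}" "{i. i < n \<and> \<not> v i} = {..<n} \<inter> - {i. v i}"
    by auto
  then show ?thesis
    by (simp add: server_lead_def server_points_def receiver_points_def sum.If_cases)
qed

lemma server_lead_0 [simp]: "server_lead v 0 = 0"
  by (simp add: server_lead_eq_sum)

lemma server_lead_case_nat [simp]:
  "server_lead (case_nat a v) (Suc n) = (if a then 1 else -1) + server_lead v n"
  unfolding server_lead_eq_sum by (subst sum.lessThan_Suc_shift) simp

text \<open>
  The score after one point is never decisive, so whether the server wins depends on the lead after
  two points and the record from there on. If the points were split, that lead is 0 and the game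
  starts afresh; otherwise it is \<open>\<plusminus>2\<close> and the game is over.
\<close>

lemma server_wins_GT_two_points:
  "server_wins_GT (case_nat a (case_nat b v)) \<longleftrightarrow> (a \<and> b) \<or> (a \<noteq> b \<and> server_wins_GT v)"
    (is "server_wins_GT ?w \<longleftrightarrow> _")
proof -
  \<comment> \<open>the lead after the two points, by which all later leads are shifted\<close>
  let ?c = "(if a then 1 else -1) + (if b then 1 else -1) :: int"
  have early: "\<bar>server_lead ?w 0\<bar> < 2" "\<bar>server_lead ?w (Suc 0)\<bar> < 2"
    by auto
  have late: "server_lead ?w (Suc (Suc n)) = ?c + server_lead v n" for n
    by simp
  have "server_wins_GT ?w \<longleftrightarrow> (\<exists>n. ?c + server_lead v n = 2 \<and> (\<forall>m<n. \<bar>?c + server_lead v m\<bar> < 2))"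
  proof
    assume "server_wins_GT ?w"
    then obtain n where n: "server_lead ?w n = 2" "\<forall>m<n. \<bar>server_lead ?w m\<bar> < 2"
      unfolding server_wins_GT_def by blast
    have "n \<noteq> 0" "n \<noteq> Suc 0"
      by (rule notI, use n(1) early in simp)+
    then obtain k where k: "n = Suc (Suc k)"
      by (metis not0_implies_Suc)
    have "?c + server_lead v k = 2"
      using n(1) unfolding k late .
    moreover have "\<bar>?c + server_lead v m\<bar> < 2" if "m < k" for m
      using n(2) that unfolding k late[symmetric] by blast
    ultimately show "\<exists>n. ?c + server_lead v n = 2 \<and> (\<forall>m<n. \<bar>?c + server_lead v m\<bar> < 2)"
      by blast
  next
    assume "\<exists>n. ?c + server_lead v n = 2 \<and> (\<forall>m<n. \<bar>?c + server_lead v m\<bar> < 2)"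
    then obtain k where k: "?c + server_lead v k = 2" "\<forall>m<k. \<bar>?c + server_lead v m\<bar> < 2"
      by blast
    have "\<bar>server_lead ?w m\<bar> < 2" if "m < Suc (Suc k)" for m
    proof -
      consider "m = 0" | "m = Suc 0" | j where "m = Suc (Suc j)"
        by (metis not0_implies_Suc)
      then show ?thesis
      proof cases
        case (3 j)
        with that k(2) show ?thesis
          unfolding 3 late by auto
      qed (use early in auto)
    qed
    with k(1) show "server_wins_GT ?w"
      unfolding server_wins_GT_def late[symmetric] by blast
  qed
  also have "\<dots> \<longleftrightarrow> (a \<and> b) \<or> (a \<noteq> b \<and> server_wins_GT v)"
  proof (cases "a = b")
    case True
    show ?thesis
    proof (cases a)
      case True
      with \<open>a = b\<close> show ?thesis
        by (auto intro!: exI[of _ 0])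
    next
      case False
      \<comment> \<open>a later lead of 2 comes too late: already after the two points the lead is -2\<close>
      have "\<not> (-2 + server_lead v n = 2 \<and> (\<forall>m<n. \<bar>-2 + server_lead v m\<bar> < 2))" for n
        by (cases n) auto
      with False \<open>a = b\<close> show ?thesis
        by simp
    qed
  next
    case False
    then have "?c = 0" by auto
    with False show ?thesis
      unfolding server_wins_GT_def by simp
  qed
  finally show ?thesis .
qed

text \<open>
  The lead takes its values in a countable set, so it suffices to know that each event
  \<open>server_lead v n = c\<close> is measurable; the bound on the absolute value is a disjunction of three
  such events.
\<close>

lemma measurable_server_wins_GT [measurable]:
  "Measurable.pred (Pi\<^sub>M UNIV (\<lambda>_::nat. count_space UNIV)) server_wins_GT"
proof -
  let ?S = "Pi\<^sub>M UNIV (\<lambda>_::nat. count_space (UNIV :: bool set))"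
  have lead [measurable]: "Measurable.pred ?S (\<lambda>v. server_lead v n = c)" for n c
  proof (induction n arbitrary: c)
    case (Suc n)
    note Suc.IH [measurable]
    have "server_lead v (Suc n) = c \<longleftrightarrow>
        (v n \<and> server_lead v n = c - 1) \<or> (\<not> v n \<and> server_lead v n = c + 1)" for v
      by (auto simp: server_lead_eq_sum)
    then show ?case
      by simp
  qed simp
  have "\<bar>k\<bar> < 2 \<longleftrightarrow> k = -1 \<or> k = 0 \<or> k = 1" for k :: int
    by auto
  then show ?thesis
    unfolding server_wins_GT_def by simp
qed

lemma sets_trials [measurable_cong]:
  "sets (trials p) = sets (Pi\<^sub>M UNIV (\<lambda>_::nat. count_space UNIV))"
  by (intro sets_PiM_cong) simp_all

lemma space_trials [simp]: "space (trials p) = UNIV"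
  by (simp add: space_PiM)

lemma prob_space_trials: "prob_space (trials p)"
  by (intro prob_space_PiM prob_space_measure_pmf)

text \<open>
  Putting one independent Bernoulli point in front of a sequence of trials gives a sequence of
  trials with the same law. Fubini for the product of that point with the remaining sequence then
  turns the probability of an event into an average over the first point.
\<close>

lemma measure_trials_first_point:
  assumes p: "p \<in> {0..1}" and P [measurable]: "Measurable.pred (trials p) P"
  shows "measure (trials p) {v. P v} =
           p * measure (trials p) {v. P (case_nat True v)} +
           (1 - p) * measure (trials p) {v. P (case_nat False v)}"
proof -
  interpret S: prob_space "trials p"
    by (rule prob_space_trials)
  interpret B: sequence_space "measure_pmf (bernoulli_pmf p)"
    by unfold_locales
  let ?f = "\<lambda>(s, v). case_nat s v :: nat \<Rightarrow> bool"
  let ?B = "measure_pmf (bernoulli_pmf p)"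
  have sets: "{v. P v} \<in> sets (trials p)"
    using P by (simp add: pred_def)
  have f: "?f \<in> measurable (?B \<Otimes>\<^sub>M trials p) (trials p)"
    by measurable
  have "emeasure (trials p) {v. P v} = emeasure (distr (?B \<Otimes>\<^sub>M trials p) (trials p) ?f) {v. P v}"
    by (simp add: B.PiM_iter)
  also have "\<dots> = emeasure (?B \<Otimes>\<^sub>M trials p) (?f -` {v. P v} \<inter> space (?B \<Otimes>\<^sub>M trials p))"
    by (rule emeasure_distr[OF f sets])
  also have "\<dots> = (\<integral>\<^sup>+ a. emeasure (trials p) (Pair a -` (?f -` {v. P v} \<inter> space (?B \<Otimes>\<^sub>M trials p))) \<partial>?B)"
    by (rule S.emeasure_pair_measure_alt) (rule measurable_sets[OF f sets])
  also have "\<dots> = (\<integral>\<^sup>+ a. emeasure (trials p) {v. P (case_nat a v)} \<partial>?B)"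
    by (simp add: space_pair_measure vimage_def)
  also have "\<dots> = ennreal p * emeasure (trials p) {v. P (case_nat True v)} +
      ennreal (1 - p) * emeasure (trials p) {v. P (case_nat False v)}"
    using p by (simp add: mult.commute)
  finally show ?thesis
    using p by (simp add: S.emeasure_eq_measure flip: ennreal_mult ennreal_plus)
qed

text \<open>
  The average over the first two points has four terms: two points for the server contribute
  \<open>p\<^sup>2\<close>, two for the receiver nothing, and each of the two ways to split the points
  contributes \<open>p * (1 - p)\<close> times the original probability.
\<close>

lemma theta_GT_first_step:
  assumes p: "p \<in> {0..1}"
  shows "theta_GT p = p\<^sup>2 + 2 * p * (1 - p) * theta_GT p"
proof -
  interpret S: prob_space "trials p"
    by (rule prob_space_trials)
  have wins: "measure (trials p) {v. server_wins_GT (case_nat a v)} =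
      p * measure (trials p) {v. server_wins_GT (case_nat a (case_nat True v))} +
      (1 - p) * measure (trials p) {v. server_wins_GT (case_nat a (case_nat False v))}" for a
    by (rule measure_trials_first_point[OF p]) measurable
  have "theta_GT p = p * measure (trials p) {v. server_wins_GT (case_nat True v)} +
      (1 - p) * measure (trials p) {v. server_wins_GT (case_nat False v)}"
    unfolding theta_GT_def by (rule measure_trials_first_point[OF p]) measurable
  then show ?thesis
    using S.prob_space
    by (simp add: wins server_wins_GT_two_points theta_GT_def[symmetric] power2_eq_square algebra_simps)
qed

lemma sum_squares_complement: "1 - 2 * p * (1 - p) = p\<^sup>2 + (1 - p)\<^sup>2" for p :: real
  by (simp add: power2_eq_square algebra_simps)

lemma sum_squares_complement_pos: "p\<^sup>2 + (1 - p)\<^sup>2 > 0" for p :: real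
  by (simp add: sum_power2_gt_zero_iff)

lemma theta_GT_eq:
  assumes "p \<in> {0..1}"
  shows "theta_GT p = p\<^sup>2 / (p\<^sup>2 + (1 - p)\<^sup>2)"
proof -
  have "theta_GT p * (1 - 2 * p * (1 - p)) = p\<^sup>2"
    using theta_GT_first_step[OF assms] by (simp add: algebra_simps)
  then show ?thesis
    using sum_squares_complement_pos[of p]
    by (simp add: sum_squares_complement eq_divide_eq)
qed

text \<open>
  Independence says exactly that the joint law of the outcomes is the product of their individual
  laws, and the event of winning depends on the outcomes only; so every model of the trials assigns
  it the probability found in the canonical one.
\<close>

lemma measure_server_wins_GT_eq_theta_GT:
  assumes "bernoulli_points M V p"
  shows "measure M {\<omega> \<in> space M. server_wins_GT (\<lambda>i. V i \<omega>)} = theta_GT p"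
proof -
  from assms have "prob_space M"
    and indep: "prob_space.indep_vars M (\<lambda>_. count_space UNIV) V UNIV"
    and V: "\<And>i. distr M (count_space UNIV) (V i) = measure_pmf (bernoulli_pmf p)"
    by (auto simp: bernoulli_points_def)
  then interpret prob_space M by simp
  have rv [measurable]: "V i \<in> measurable M (count_space UNIV)" for i
    using indep by (simp add: indep_vars_def)
  let ?S = "Pi\<^sub>M UNIV (\<lambda>_::nat. count_space (UNIV :: bool set))"
  have "distr M ?S (\<lambda>\<omega>. \<lambda>i\<in>UNIV. V i \<omega>) = Pi\<^sub>M UNIV (\<lambda>i. distr M (count_space UNIV) (V i))"
    using indep by (subst (asm) indep_vars_iff_distr_eq_PiM) auto
  then have law: "distr M ?S (\<lambda>\<omega> i. V i \<omega>) = trials p"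
    by (simp add: V restrict_UNIV)
  have "measure (distr M ?S (\<lambda>\<omega> i. V i \<omega>)) {v. server_wins_GT v} =
      measure M ((\<lambda>\<omega> i. V i \<omega>) -` {v. server_wins_GT v} \<inter> space M)"
  proof (rule measure_distr)
    show "(\<lambda>\<omega> i. V i \<omega>) \<in> measurable M ?S"
      by (rule measurable_PiM_single') (auto simp: space_PiM)
    show "{v. server_wins_GT v} \<in> sets ?S"
      using measurable_server_wins_GT by (simp add: pred_def space_PiM)
  qed
  then show ?thesis
    by (simp add: law theta_GT_def vimage_def Int_def conj_commute)
qed

theorem proposition2p2:
  fixes p q :: real
  assumes "p \<in> {0..1}" and "q = 1 - p"
  shows "(\<forall>(M :: 'a measure) V. bernoulli_points M V p \<longrightarrow>
            measure M {\<omega> \<in> space M. server_wins_GT (\<lambda>i. V i \<omega>)} = theta_GT p) \<and>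
         theta_GT p = p\<^sup>2 / (1 - 2 * p * q) \<and>
         p\<^sup>2 / (1 - 2 * p * q) = p\<^sup>2 / (p\<^sup>2 + q\<^sup>2) \<and>
         (p < 1 \<longrightarrow> theta_GT p = (ODDS p)\<^sup>2 / (1 + (ODDS p)\<^sup>2)) \<and>
         theta_GT (1 - p) = 1 - theta_GT p"
proof (intro conjI)
  note theta = theta_GT_eq[OF assms(1)]
  show "\<forall>(M :: 'a measure) V. bernoulli_points M V p \<longrightarrow>
            measure M {\<omega> \<in> space M. server_wins_GT (\<lambda>i. V i \<omega>)} = theta_GT p"
    by (blast intro: measure_server_wins_GT_eq_theta_GT)
  show "theta_GT p = p\<^sup>2 / (1 - 2 * p * q)" "p\<^sup>2 / (1 - 2 * p * q) = p\<^sup>2 / (p\<^sup>2 + q\<^sup>2)"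
    by (simp_all add: theta assms(2) sum_squares_complement)
  show "p < 1 \<longrightarrow> theta_GT p = (ODDS p)\<^sup>2 / (1 + (ODDS p)\<^sup>2)"
  proof
    assume "p < 1"
    then have q2: "(1 - p)\<^sup>2 \<noteq> 0" by simp
    have "(ODDS p)\<^sup>2 / (1 + (ODDS p)\<^sup>2) = (p\<^sup>2 / (1 - p)\<^sup>2) / (((1 - p)\<^sup>2 + p\<^sup>2) / (1 - p)\<^sup>2)"
      using q2 by (simp add: ODDS_def power_divide add_divide_distrib)
    also have "\<dots> = p\<^sup>2 / (p\<^sup>2 + (1 - p)\<^sup>2)"
      using q2 by (simp add: add.commute)
    finally show "theta_GT p = (ODDS p)\<^sup>2 / (1 + (ODDS p)\<^sup>2)"
      by (simp add: theta)
  qed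
  have "theta_GT (1 - p) = (1 - p)\<^sup>2 / (p\<^sup>2 + (1 - p)\<^sup>2)"
    using theta_GT_eq[of "1 - p"] assms(1) by (simp add: add.commute)
  then show "theta_GT (1 - p) = 1 - theta_GT p"
    using sum_squares_complement_pos[of p] by (simp add: theta field_simps)
qed

end
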